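(* Let $G=C_{n,n}$ be the crown graph with $n\ge 4$, and let $J_G$ be its binomial edge ideal. Then $3\le\mathrm{v}(J_G)\le 4$.
   Context: The crown graph $C_{n,n}$ is the bipartite graph with vertex set $\{1,\ldots,2n\}$, parts $X=\{2i-1 : 1\le i\le n\}$ and $Y=\{2i : 1\le i\le n\}$, and edges $\{2i-1,2j\}$ for all $i,j\in\{1,\ldots,n\}$ with $i\ne j$. Here $\mathbb{K}$ is an arbitrary field, $S=\mathbb{K}[x_1,\ldots,x_{2n},y_1,\ldots,y_{2n}]$ (standard graded, with degree-$d$ component $S_d$), and $J_G=\langle x_iy_j-x_jy_i : \{i,j\}\in E(G)\rangle$. For a proper nonzero homogeneous ideal $I\subseteq S$ and $\mathfrak{p}\in\mathrm{Ass}(I)$, the local $\mathrm{v}$-number is $\mathrm{v}_{\mathfrak{p}}(I)=\min\{d : \exists f\in S_d \text{ with } I:f=\mathfrak{p}\}$, and the $\mathrm{v}$-number is $\mathrm{v}(I)=\min\{\mathrm{v}_{\mathfrak{p}}(I) : \mathfrak{p}\in\mathrm{Ass}(I)\}$. *)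

theory Defs
  imports
    "HOL-Algebra.Ideal"
    "HOL-Library.Poly_Mapping"
    "HOL-Library.Extended_Nat"
begin

section \<open>Polynomial rings\<close>

text \<open>
  Polynomials are finitely supported maps from monomials to coefficients, a monomial being a
  finitely supported map from variables to exponents.  Addition and multiplication are those of
  \<open>Poly_Mapping\<close>, i.e. multiplication is the convolution product.
\<close>

type_synonym ('v, 'k) mpoly = "('v \<Rightarrow>\<^sub>0 nat) \<Rightarrow>\<^sub>0 'k"

definition var :: "'v \<Rightarrow> ('v, 'k::field) mpoly"
  where "var v = Poly_Mapping.single (Poly_Mapping.single v 1) 1"

text \<open>
  \<open>poly_ring V\<close> is the ring \<open>K[V]\<close>; a type of variables may be larger than the set \<open>V\<close> of those
  that are allowed to occur.  The field \<open>K\<close> is the type \<open>'k\<close>.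
\<close>

definition poly_ring :: "'v set \<Rightarrow> ('v, 'k::field) mpoly ring"
  where "poly_ring V =
    \<lparr>carrier = {p. \<forall>m\<in>Poly_Mapping.keys p. Poly_Mapping.keys m \<subseteq> V},
     mult = (*), one = 1, zero = 0, add = (+)\<rparr>"

definition monom_degree :: "('v \<Rightarrow>\<^sub>0 nat) \<Rightarrow> nat"
  where "monom_degree m = (\<Sum>v\<in>Poly_Mapping.keys m. Poly_Mapping.lookup m v)"

text \<open>The component of degree \<open>d\<close> in the standard grading; it contains \<open>0\<close> for every \<open>d\<close>.\<close>

definition hom_component :: "'v set \<Rightarrow> nat \<Rightarrow> ('v, 'k::field) mpoly set"
  where "hom_component V d =
    {p \<in> carrier (poly_ring V). \<forall>m\<in>Poly_Mapping.keys p. monom_degree m = d}"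

lemma cring_poly_ring: "cring (poly_ring V :: ('v, 'k::field) mpoly ring)"
proof (rule cringI)
  show "abelian_group (poly_ring V :: ('v, 'k) mpoly ring)"
  proof (rule abelian_groupI)
    fix p :: "('v, 'k) mpoly"
    assume p: "p \<in> carrier (poly_ring V)"
    have "- p \<in> carrier (poly_ring V)"
      using p by (simp add: poly_ring_def in_keys_iff)
    then show "\<exists>q\<in>carrier (poly_ring V). q \<oplus>\<^bsub>poly_ring V\<^esub> p = \<zero>\<^bsub>poly_ring V\<^esub>"
      by (rule bexI[rotated]) (simp add: poly_ring_def)
  next
    fix p q :: "('v, 'k) mpoly"
    assume "p \<in> carrier (poly_ring V)" "q \<in> carrier (poly_ring V)"
    then show "p \<oplus>\<^bsub>poly_ring V\<^esub> q \<in> carrier (poly_ring V)"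
      using Poly_Mapping.keys_add[of p q] by (auto simp: poly_ring_def)
  qed (auto simp: poly_ring_def ac_simps)
  show "comm_monoid (poly_ring V :: ('v, 'k) mpoly ring)"
  proof (rule comm_monoidI)
    fix p q :: "('v, 'k) mpoly"
    assume pq: "p \<in> carrier (poly_ring V)" "q \<in> carrier (poly_ring V)"
    have "Poly_Mapping.keys m \<subseteq> V" if m: "m \<in> Poly_Mapping.keys (p * q)" for m
    proof -
      obtain a b where ab: "a \<in> Poly_Mapping.keys p" "b \<in> Poly_Mapping.keys q" "m = a + b"
        using m Poly_Mapping.keys_mult[of p q] by auto
      then have "Poly_Mapping.keys a \<subseteq> V" "Poly_Mapping.keys b \<subseteq> V"
        using pq by (auto simp: poly_ring_def)
      then show ?thesis
        using Poly_Mapping.keys_add[of a b] ab(3) by blast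
    qed
    then show "p \<otimes>\<^bsub>poly_ring V\<^esub> q \<in> carrier (poly_ring V)"
      by (simp add: poly_ring_def)
  next
    show "\<one>\<^bsub>poly_ring V\<^esub> \<in> carrier (poly_ring V :: ('v, 'k) mpoly ring)"
      by (simp add: poly_ring_def)
  qed (auto simp: poly_ring_def ac_simps)
qed (simp add: poly_ring_def distrib_right)

lemma var_in_carrier: "v \<in> V \<Longrightarrow> (var v :: ('v, 'k::field) mpoly) \<in> carrier (poly_ring V)"
  by (simp add: var_def poly_ring_def)


section \<open>Associated primes and v-numbers\<close>

definition colon :: "('a, 'b) ring_scheme \<Rightarrow> 'a set \<Rightarrow> 'a \<Rightarrow> 'a set"
  where "colon R I f = {g \<in> carrier R. g \<otimes>\<^bsub>R\<^esub> f \<in> I}"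

definition Ass :: "('a, 'b) ring_scheme \<Rightarrow> 'a set \<Rightarrow> 'a set set"
  where "Ass R I = {P. primeideal P R \<and> (\<exists>f\<in>carrier R. colon R I f = P)}"

text \<open>
  For an ideal \<open>I\<close> of \<open>K[V]\<close>.  The minima are infima in \<^typ>\<open>enat\<close>: these are attained whenever the
  set is nonempty, and the infimum of the empty set is \<open>\<infinity>\<close> rather than some natural number.
\<close>

definition local_v_number :: "'v set \<Rightarrow> ('v, 'k::field) mpoly set \<Rightarrow> ('v, 'k) mpoly set \<Rightarrow> enat"
  where "local_v_number V I P =
    Inf {enat d | d. \<exists>f\<in>hom_component V d. colon (poly_ring V) I f = P}"

definition v_number :: "'v set \<Rightarrow> ('v, 'k::field) mpoly set \<Rightarrow> enat"
  where "v_number V I = Inf {local_v_number V I P | P. P \<in> Ass (poly_ring V) I}"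


section \<open>Binomial edge ideals and crown graphs\<close>

text \<open>A graph is a pair of its vertex set and its set of edges, which are two-element sets.\<close>

type_synonym 'a graph = "'a set \<times> 'a set set"

datatype 'a xy_var = XVar 'a | YVar 'a

definition xy_vars :: "'a graph \<Rightarrow> 'a xy_var set"
  where "xy_vars G = XVar ` fst G \<union> YVar ` fst G"

text \<open>
  Each edge contributes its binomial with both signs, as \<open>(i, j)\<close> and \<open>(j, i)\<close> both occur below.
\<close>

definition binomial_edge_ideal :: "'a graph \<Rightarrow> ('a xy_var, 'k::field) mpoly set"
  where "binomial_edge_ideal G =
    Idl\<^bsub>poly_ring (xy_vars G)\<^esub>
      {var (XVar i) * var (YVar j) - var (XVar j) * var (YVar i) | i j. {i, j} \<in> snd G}"

definition crown_graph :: "nat \<Rightarrow> nat graph"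
  where "crown_graph n =
    ({1..2 * n}, {{2 * i - 1, 2 * j} | i j. i \<in> {1..n} \<and> j \<in> {1..n} \<and> i \<noteq> j})"

end

theory Submission
  imports Defs
begin

text \<open>
  Write \<open>a\<^sub>i = 2 i - 1\<close> and \<open>b\<^sub>i = 2 i\<close> for the vertices of the crown graph, so that \<open>a\<^sub>i\<close> and \<open>b\<^sub>j\<close>
  are adjacent if and only if \<open>i \<noteq> j\<close>, and \<open>f\<^sub>u\<^sub>v\<close> for the minor \<open>x\<^sub>u y\<^sub>v - x\<^sub>v y\<^sub>u\<close>.

  The minimal primes of a binomial edge ideal \<open>J\<close> come from vertex sets \<open>T\<close>: the prime of \<open>T\<close> is
  generated by the variables at the vertices of \<open>T\<close> and by the minors inside each connected component
  of the graph without \<open>T\<close>.  Each such prime is the kernel of the map that sends the variables at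
  \<open>T\<close> to \<open>0\<close> and otherwise \<open>x\<^sub>v\<close> to \<open>t\<^sub>v\<close> and \<open>y\<^sub>v\<close> to \<open>s\<^sub>C t\<^sub>v\<close>, where \<open>C\<close> is the component of \<open>v\<close>.
  The proof works with these maps (\<open>label_hom\<close>).  Up to the killed variables they send
  monomials to monomials, and their target is an integral domain, so that their kernels are visibly
  prime.

  Lower bound.  Let \<open>J : f = P\<close> be prime with \<open>f\<close> of degree at most \<open>2\<close>.  If \<open>J\<close> lies in the kernel
  \<open>Q\<close> of such a map, then \<open>P f \<subseteq> Q\<close>, hence \<open>f \<in> Q\<close> or \<open>P \<subseteq> Q\<close>.  For the
  pairs of kernels compared below, the second case cannot occur for both: for a path \<open>u - w - v\<close> the product \<open>x\<^sub>w f\<^sub>u\<^sub>v\<close> lies in \<open>J \<subseteq> P\<close>, so if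
  the first map keeps \<open>w\<close> and the second one separates \<open>u\<close> from \<open>v\<close>, then neither factor could lie in \<open>P\<close>
  (\<open>in_one_of_two_kernels\<close>).  The kernels used are those of \<open>T = {}\<close>, of the two sides of the
  bipartition, and of the complements of \<open>{a\<^sub>i, b\<^sub>i, a\<^sub>j, b\<^sub>j}\<close>, which leave the two edges \<open>a\<^sub>i b\<^sub>j\<close> and
  \<open>a\<^sub>j b\<^sub>i\<close>.  After subtracting from \<open>f\<close> a suitable combination of the generators of \<open>J\<close>, every
  monomial that is left has, for two of these maps, a nonzero image that no other remaining monomial
  shares; one of the two maps annihilates \<open>f\<close>, so the coefficient vanishes.  Hence \<open>f \<in> J\<close> and \<open>1 \<in> P\<close>, a
  contradiction (\<open>low_degree_in_J\<close>).

  Upper bound.  For \<open>f = x\<^sub>a\<^sub>1 x\<^sub>a\<^sub>2 x\<^sub>b\<^sub>3 x\<^sub>b\<^sub>4\<close> the colon ideal \<open>J : f\<close> is the kernel for \<open>T = {}\<close>.  Any two vertices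
  are adjacent or joined by a path whose inner vertices are among \<open>a\<^sub>1, a\<^sub>2, b\<^sub>3, b\<^sub>4\<close>, and the product of the inner
  \<open>x\<close>-variables of a path with the minor of its ends lies in \<open>J\<close>; hence \<open>J : f\<close> contains
  all \<open>2\<close>-minors of the generic \<open>2 \<times> 2n\<close> matrix (\<open>minor_times_witness\<close>), and these generate the
  kernel (\<open>kernel_generated_by_minors\<close>).  Conversely \<open>J : f\<close> lies in the kernel, as the map sends
  \<open>J\<close> to \<open>0\<close> but not \<open>f\<close>.
\<close>

section \<open>Monomials\<close>

lemma lookup_single_nat:
  "Poly_Mapping.lookup (Poly_Mapping.single k (a::nat)) k' = (if k = k' then a else 0)"
  by (simp add: lookup_single when_def)

lemma keys_plus_nat: "Poly_Mapping.keys (m + m' :: 'v \<Rightarrow>\<^sub>0 nat) = Poly_Mapping.keys m \<union> Poly_Mapping.keys m'"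
  by (auto simp: in_keys_iff lookup_add)

lemma sum_keys_superset:
  fixes m :: "'v \<Rightarrow>\<^sub>0 'a::zero"
  assumes "finite A" "Poly_Mapping.keys m \<subseteq> A" "\<And>z. F z 0 = 0"
  shows "(\<Sum>z\<in>Poly_Mapping.keys m. F z (Poly_Mapping.lookup m z)) = (\<Sum>z\<in>A. F z (Poly_Mapping.lookup m z))"
  by (rule sum.mono_neutral_left) (use assms in \<open>auto simp: in_keys_iff\<close>)

text \<open>
  Applied to exponents, for the degree and the image of a monomial, and to coefficients, for linear
  maps on polynomials.
\<close>

lemma sum_keys_add:
  fixes m m' :: "'v \<Rightarrow>\<^sub>0 'a::monoid_add"
  assumes "\<And>z. F z 0 = 0" "\<And>z a b. F z (a + b) = F z a + F z b"
  shows "(\<Sum>z\<in>Poly_Mapping.keys (m + m'). F z (Poly_Mapping.lookup (m + m') z)) =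
    (\<Sum>z\<in>Poly_Mapping.keys m. F z (Poly_Mapping.lookup m z)) +
    (\<Sum>z\<in>Poly_Mapping.keys m'. F z (Poly_Mapping.lookup m' z))"
proof -
  let ?A = "Poly_Mapping.keys m \<union> Poly_Mapping.keys m'"
  show ?thesis
    using Poly_Mapping.keys_add[of m m'] assms sum_keys_superset[of ?A "m + m'" F]
      sum_keys_superset[of ?A m F] sum_keys_superset[of ?A m' F]
    by (simp add: lookup_add sum.distrib)
qed

lemma monom_degree_plus: "monom_degree (m + m') = monom_degree m + monom_degree m'"
  unfolding monom_degree_def by (rule sum_keys_add[where F = "\<lambda>_ a. a"]) auto

lemma monom_degree_single: "monom_degree (Poly_Mapping.single z a) = a"
  by (simp add: monom_degree_def)

lemma monom_degree_0_iff: "monom_degree m = 0 \<longleftrightarrow> m = 0"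
  by (auto simp: monom_degree_def in_keys_iff intro: poly_mapping_eqI)

lemma peel_variable:
  assumes "z \<in> Poly_Mapping.keys (m :: 'v \<Rightarrow>\<^sub>0 nat)"
  obtains m' where "m = Poly_Mapping.single z 1 + m'"
proof
  show "m = Poly_Mapping.single z 1 + (m - Poly_Mapping.single z 1)"
    using assms
    by (intro poly_mapping_eqI) (auto simp: lookup_add lookup_minus lookup_single_nat in_keys_iff)
qed

section \<open>Polynomials\<close>

lemma sum_single: "(\<Sum>i\<in>A. Poly_Mapping.single k (a i)) = Poly_Mapping.single k (\<Sum>i\<in>A. a i)"
  by (intro poly_mapping_eqI) (simp add: lookup_sum lookup_single when_def)

lemma poly_as_sum:
  "p = (\<Sum>m\<in>Poly_Mapping.keys p. Poly_Mapping.single m (Poly_Mapping.lookup p m))"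
  by (intro poly_mapping_eqI)
    (auto simp: lookup_sum lookup_single when_def sum.delta' in_keys_iff)

lemma keys_diff_subset:
  "Poly_Mapping.keys (p - q :: 'v \<Rightarrow>\<^sub>0 'a::ab_group_add) \<subseteq> Poly_Mapping.keys p \<union> Poly_Mapping.keys q"
  by (auto simp: in_keys_iff lookup_minus)

lemma poly_ring_simps [simp]:
  "mult (poly_ring V) = (*)" "one (poly_ring V) = 1" "zero (poly_ring V) = 0"
  "add (poly_ring V) = (+)"
  by (simp_all add: poly_ring_def)

lemma in_carrier_poly_ring:
  "p \<in> carrier (poly_ring V) \<longleftrightarrow> (\<forall>m\<in>Poly_Mapping.keys p. Poly_Mapping.keys m \<subseteq> V)"
  by (simp add: poly_ring_def)

lemma carrier_mult:
  fixes p q :: "('v, 'k::field) mpoly"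
  assumes "p \<in> carrier (poly_ring V)" "q \<in> carrier (poly_ring V)"
  shows "p * q \<in> carrier (poly_ring V)"
proof -
  interpret cring "poly_ring V :: ('v, 'k) mpoly ring" by (rule cring_poly_ring)
  show ?thesis using m_closed[OF assms] by simp
qed

lemma carrier_add:
  fixes p q :: "('v, 'k::field) mpoly"
  assumes "p \<in> carrier (poly_ring V)" "q \<in> carrier (poly_ring V)"
  shows "p + q \<in> carrier (poly_ring V)"
  using assms Poly_Mapping.keys_add[of p q] by (auto simp: in_carrier_poly_ring)

lemma carrier_diff:
  fixes p q :: "('v, 'k::field) mpoly"
  assumes "p \<in> carrier (poly_ring V)" "q \<in> carrier (poly_ring V)"
  shows "p - q \<in> carrier (poly_ring V)"
  using assms keys_diff_subset[of p q] by (auto simp: in_carrier_poly_ring)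

lemma carrier_single: "Poly_Mapping.keys m \<subseteq> V \<Longrightarrow> Poly_Mapping.single m a \<in> carrier (poly_ring V)"
  by (auto simp: in_carrier_poly_ring)

lemma poly_idealI:
  fixes I :: "('v, 'k::field) mpoly set"
  assumes sub: "I \<subseteq> carrier (poly_ring V)" and zero: "0 \<in> I"
    and add: "\<And>p q. p \<in> I \<Longrightarrow> q \<in> I \<Longrightarrow> p + q \<in> I"
    and mult: "\<And>p q. p \<in> I \<Longrightarrow> q \<in> carrier (poly_ring V) \<Longrightarrow> q * p \<in> I"
  shows "ideal I (poly_ring V)"
proof -
  interpret cring "poly_ring V :: ('v, 'k) mpoly ring" by (rule cring_poly_ring)
  have uminus: "- p \<in> I" if "p \<in> I" for p
    using mult[OF that, of "Poly_Mapping.single 0 (-1)"]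
    by (simp add: in_carrier_poly_ring single_uminus)
  show ?thesis
  proof (rule idealI[OF ring_axioms])
    show "subgroup I (add_monoid (poly_ring V))"
    proof (rule group.subgroupI[OF a_group])
      fix p assume p: "p \<in> I"
      then have "inv\<^bsub>add_monoid (poly_ring V)\<^esub> p = - p"
        using sub uminus by (intro group.inv_equality[OF a_group]) auto
      with p show "inv\<^bsub>add_monoid (poly_ring V)\<^esub> p \<in> I" by (simp add: uminus)
    qed (use assms in auto)
  qed (use mult in \<open>auto simp: mult.commute\<close>)
qed

context
  fixes V :: "'v set" and I :: "('v, 'k::field) mpoly set"
  assumes I: "ideal I (poly_ring V)"
begin

lemma ideal_poly_carrier: "p \<in> I \<Longrightarrow> p \<in> carrier (poly_ring V)"
  using additive_subgroup.a_subset[OF ideal.axioms(1)[OF I]] by auto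

lemma ideal_poly_zero: "0 \<in> I"
  using additive_subgroup.zero_closed[OF ideal.axioms(1)[OF I]] by simp

lemma ideal_poly_add: "p \<in> I \<Longrightarrow> q \<in> I \<Longrightarrow> p + q \<in> I"
  using additive_subgroup.a_closed[OF ideal.axioms(1)[OF I], of p q] by simp

lemma ideal_poly_mult: "p \<in> I \<Longrightarrow> q \<in> carrier (poly_ring V) \<Longrightarrow> q * p \<in> I"
  using ideal.I_l_closed[OF I, of p q] by simp

lemma ideal_poly_uminus: "p \<in> I \<Longrightarrow> - p \<in> I"
  using ideal_poly_mult[of p "Poly_Mapping.single 0 (-1)"]
  by (simp add: in_carrier_poly_ring single_uminus)

lemma ideal_poly_diff: "p \<in> I \<Longrightarrow> q \<in> I \<Longrightarrow> p - q \<in> I"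
  using ideal_poly_add[of p "- q"] ideal_poly_uminus by simp

lemma ideal_poly_sum: "(\<And>i. i \<in> A \<Longrightarrow> F i \<in> I) \<Longrightarrow> sum F A \<in> I"
  by (induction A rule: infinite_finite_induct) (auto intro: ideal_poly_zero ideal_poly_add)

lemma colon_ideal: "ideal (colon (poly_ring V) I f) (poly_ring V)"
  by (rule poly_idealI)
    (auto simp: colon_def distrib_right mult.assoc in_carrier_poly_ring[of 0] ideal_poly_zero
      carrier_add carrier_mult intro: ideal_poly_add ideal_poly_mult)

end

section \<open>Minors\<close>

definition xy :: "'a \<Rightarrow> 'a \<Rightarrow> ('a xy_var \<Rightarrow>\<^sub>0 nat)"
  where "xy u v = Poly_Mapping.single (XVar u) 1 + Poly_Mapping.single (YVar v) 1"

definition minor :: "'a \<Rightarrow> 'a \<Rightarrow> ('a xy_var, 'k::field) mpoly"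
  where "minor u v = var (XVar u) * var (YVar v) - var (XVar v) * var (YVar u)"

lemma minor_eq: "minor u v = Poly_Mapping.single (xy u v) 1 - Poly_Mapping.single (xy v u) 1"
  by (simp add: minor_def var_def mult_single xy_def)

lemma minor_swap: "minor v u = - minor u v"
  by (simp add: minor_def)

lemma keys_xy: "Poly_Mapping.keys (xy u v) = {XVar u, YVar v}"
  by (auto simp: xy_def keys_plus_nat)

lemma xy_inject [simp]: "xy u v = xy u' v' \<longleftrightarrow> u = u' \<and> v = v'"
proof
  assume "xy u v = xy u' v'"
  then have "Poly_Mapping.keys (xy u v) = Poly_Mapping.keys (xy u' v')" by simp
  then show "u = u' \<and> v = v'" by (auto simp: keys_xy)
qed simp

lemma monom_degree_xy: "monom_degree (xy u v) = 2"
  by (simp add: xy_def monom_degree_plus monom_degree_single)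

lemma xy_vars_iff [simp]:
  "XVar v \<in> xy_vars G \<longleftrightarrow> v \<in> fst G" "YVar v \<in> xy_vars G \<longleftrightarrow> v \<in> fst G"
  by (auto simp: xy_vars_def)

lemma minor_in_carrier:
  "u \<in> fst G \<Longrightarrow> v \<in> fst G \<Longrightarrow> minor u v \<in> carrier (poly_ring (xy_vars G))"
  unfolding minor_eq by (intro carrier_diff carrier_single) (auto simp: keys_xy)

text \<open>
  This comes from the Pluecker relation \<open>x\<^sub>w f\<^sub>u\<^sub>v = x\<^sub>u f\<^sub>w\<^sub>v - x\<^sub>v f\<^sub>w\<^sub>u\<close>.  It concatenates paths
  from \<open>w\<close> to \<open>u\<close> and from \<open>w\<close> to \<open>v\<close> at the price of the variable at \<open>w\<close>; \<open>p\<close> and \<open>q\<close> collect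
  the variables at the inner vertices of the two paths.
\<close>

lemma minor_chain:
  fixes I :: "('a xy_var, 'k::field) mpoly set"
  assumes I: "ideal I (poly_ring (xy_vars G))"
    and uv: "u \<in> fst G" "v \<in> fst G"
    and pq: "p \<in> carrier (poly_ring (xy_vars G))" "q \<in> carrier (poly_ring (xy_vars G))"
    and m: "p * minor w u \<in> I" "q * minor w v \<in> I"
  shows "p * q * var (XVar w) * minor u v \<in> I"
proof -
  have "p * q * var (XVar w) * minor u v =
      (p * var (XVar u)) * (q * minor w v) - (q * var (XVar v)) * (p * minor w u)"
    by (simp add: minor_def algebra_simps)
  moreover have "(p * var (XVar u)) * (q * minor w v) \<in> I"
    using uv pq by (intro ideal_poly_mult[OF I m(2)] carrier_mult var_in_carrier) auto
  moreover have "(q * var (XVar v)) * (p * minor w u) \<in> I"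
    using uv pq by (intro ideal_poly_mult[OF I m(1)] carrier_mult var_in_carrier) auto
  ultimately show ?thesis using ideal_poly_diff[OF I] by simp
qed

section \<open>Vertex labellings and the kernels of their monomial maps\<close>

primrec vertex :: "'a xy_var \<Rightarrow> 'a" where
  "vertex (XVar v) = v" | "vertex (YVar v) = v"

text \<open>
  A labelling sends a vertex to \<open>None\<close> if its variables are to be killed, and otherwise to the name of
  its component.  The target variables \<open>t\<^sub>v\<close> and \<open>s\<^sub>l\<close> are encoded as the numbers \<open>2 v\<close> and
  \<open>2 l + 1\<close>: linearly ordered variables make the target ring an integral domain by a
  type class instance.  The argument \<open>e\<close> is the exponent of the variable.  The value \<open>the None\<close> at a
  killed vertex does no harm, since \<open>survives\<close> excludes such monomials from \<open>label_hom\<close>.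
\<close>

primrec var_image :: "(nat \<Rightarrow> nat option) \<Rightarrow> nat xy_var \<Rightarrow> nat \<Rightarrow> (nat \<Rightarrow>\<^sub>0 nat)" where
  "var_image c (XVar v) e = Poly_Mapping.single (2 * v) e"
| "var_image c (YVar v) e = Poly_Mapping.single (2 * v) e + Poly_Mapping.single (2 * the (c v) + 1) e"

definition monom_image :: "(nat \<Rightarrow> nat option) \<Rightarrow> (nat xy_var \<Rightarrow>\<^sub>0 nat) \<Rightarrow> (nat \<Rightarrow>\<^sub>0 nat)"
  where "monom_image c m = (\<Sum>z\<in>Poly_Mapping.keys m. var_image c z (Poly_Mapping.lookup m z))"

definition survives :: "(nat \<Rightarrow> nat option) \<Rightarrow> (nat xy_var \<Rightarrow>\<^sub>0 nat) \<Rightarrow> bool"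
  where "survives c m \<longleftrightarrow> (\<forall>z\<in>Poly_Mapping.keys m. c (vertex z) \<noteq> None)"

definition label_hom :: "(nat \<Rightarrow> nat option) \<Rightarrow> (nat xy_var, 'k::field) mpoly \<Rightarrow> (nat, 'k) mpoly"
  where "label_hom c p = (\<Sum>m\<in>Poly_Mapping.keys p.
    if survives c m then Poly_Mapping.single (monom_image c m) (Poly_Mapping.lookup p m) else 0)"

lemma var_image_0: "var_image c z 0 = 0"
  by (cases z) auto

lemma var_image_add: "var_image c z (a + b) = var_image c z a + var_image c z b"
  by (cases z) (auto simp: single_add algebra_simps)

lemma monom_image_plus: "monom_image c (m + m') = monom_image c m + monom_image c m'"
  unfolding monom_image_def by (rule sum_keys_add) (auto simp: var_image_0 var_image_add)

lemma monom_image_single: "monom_image c (Poly_Mapping.single z e) = var_image c z e"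
  by (simp add: monom_image_def var_image_0)

lemma monom_image_0: "monom_image c 0 = 0"
  by (simp add: monom_image_def)

lemma survives_plus: "survives c (m + m') \<longleftrightarrow> survives c m \<and> survives c m'"
  by (auto simp: survives_def keys_plus_nat)

lemma label_hom_0 [simp]: "label_hom c 0 = 0"
  by (simp add: label_hom_def)

lemma label_hom_add: "label_hom c (p + q) = label_hom c p + label_hom c q"
  unfolding label_hom_def
  by (rule sum_keys_add[where F = "\<lambda>m a. if survives c m then Poly_Mapping.single (monom_image c m) a else 0"])
    (auto simp: single_add)

lemma label_hom_uminus: "label_hom c (- p) = - label_hom c p"
  using label_hom_add[of c p "- p"] by (simp add: eq_neg_iff_add_eq_0 add.commute)

lemma label_hom_diff: "label_hom c (p - q) = label_hom c p - label_hom c q"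
  using label_hom_add[of c p "- q"] by (simp add: label_hom_uminus)

lemma label_hom_single:
  "label_hom c (Poly_Mapping.single m a) =
    (if survives c m then Poly_Mapping.single (monom_image c m) a else 0)"
  by (simp add: label_hom_def)

lemma label_hom_sum: "label_hom c (sum F A) = (\<Sum>i\<in>A. label_hom c (F i))"
  by (induction A rule: infinite_finite_induct) (auto simp: label_hom_add)

lemma label_hom_mult: "label_hom c (p * q) = label_hom c p * label_hom c q"
proof -
  let ?s = "\<lambda>p m. Poly_Mapping.single m (Poly_Mapping.lookup p m)"
  have *: "label_hom c (?s p m * ?s q m') = label_hom c (?s p m) * label_hom c (?s q m')" for m m'
    by (simp add: mult_single label_hom_single survives_plus monom_image_plus)
  have "p * q = (\<Sum>m\<in>Poly_Mapping.keys p. \<Sum>m'\<in>Poly_Mapping.keys q. ?s p m * ?s q m')"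
    by (simp flip: sum_product poly_as_sum)
  then have "label_hom c (p * q) =
      (\<Sum>m\<in>Poly_Mapping.keys p. label_hom c (?s p m)) * (\<Sum>m'\<in>Poly_Mapping.keys q. label_hom c (?s q m'))"
    by (simp add: label_hom_sum * sum_product)
  also have "\<dots> = label_hom c p * label_hom c q"
    by (simp flip: label_hom_sum poly_as_sum)
  finally show ?thesis .
qed

lemma lookup_label_hom:
  "Poly_Mapping.lookup (label_hom c p) M =
    (\<Sum>m\<in>{m \<in> Poly_Mapping.keys p. survives c m \<and> monom_image c m = M}. Poly_Mapping.lookup p m)"
proof -
  have "Poly_Mapping.lookup (label_hom c p) M = (\<Sum>m\<in>Poly_Mapping.keys p.
      if survives c m \<and> monom_image c m = M then Poly_Mapping.lookup p m else 0)"
    unfolding label_hom_def lookup_sum by (rule sum.cong) (auto simp: lookup_single)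
  then show ?thesis by (simp add: sum.If_cases Int_def)
qed

lemma label_hom_minor_eq_0_iff:
  "label_hom c (minor u v :: (nat xy_var, 'k::field) mpoly) = 0 \<longleftrightarrow> c u = None \<or> c v = None \<or> c u = c v"
proof -
  have "monom_image c (xy u v) = monom_image c (xy v u) \<longleftrightarrow> the (c u) = the (c v)"
  proof
    assume "monom_image c (xy u v) = monom_image c (xy v u)"
    then have "Poly_Mapping.lookup (monom_image c (xy u v)) (2 * the (c u) + 1) =
        Poly_Mapping.lookup (monom_image c (xy v u)) (2 * the (c u) + 1)" by simp
    then show "the (c u) = the (c v)"
      by (simp add: xy_def monom_image_plus monom_image_single lookup_add lookup_single_nat
          split: if_splits)
  qed (simp add: xy_def monom_image_plus monom_image_single algebra_simps)
  then have "Poly_Mapping.single (monom_image c (xy u v)) (1::'k) = Poly_Mapping.single (monom_image c (xy v u)) 1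
      \<longleftrightarrow> the (c u) = the (c v)"
    by (metis keys_single singleton_inject zero_neq_one)
  then show ?thesis
    by (auto simp: minor_eq label_hom_diff label_hom_single survives_def keys_xy)
qed

lemma prime_kernel:
  "primeideal {p \<in> carrier (poly_ring V). label_hom c p = 0}
    (poly_ring V :: (nat xy_var, 'k::field) mpoly ring)" (is "primeideal ?K ?R")
proof -
  interpret cring ?R by (rule cring_poly_ring)
  have ideal: "ideal ?K ?R"
    by (rule poly_idealI)
      (auto simp: in_carrier_poly_ring[of 0] carrier_add carrier_mult label_hom_add label_hom_mult)
  show ?thesis
  proof (rule primeidealI[OF ideal cring_axioms])
    have "label_hom c (1 :: (nat xy_var, 'k) mpoly) = 1"
      using label_hom_single[of c 0 "1::'k"] by (simp add: survives_def monom_image_0)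
    then have "1 \<notin> ?K" by simp
    then show "carrier ?R \<noteq> ?K" using one_closed by auto
  qed (auto simp: label_hom_mult)
qed

text \<open>
  The tool for showing that a coefficient of an element of a kernel vanishes: no other monomial of
  the polynomial may cancel against it.
\<close>

lemma lookup_label_hom_isolated:
  assumes "survives c m"
    and "\<And>m'. m' \<in> Poly_Mapping.keys p \<Longrightarrow> survives c m' \<Longrightarrow> monom_image c m' = monom_image c m \<Longrightarrow> m' = m"
  shows "Poly_Mapping.lookup (label_hom c p) (monom_image c m) = Poly_Mapping.lookup p m"
proof -
  have "{m' \<in> Poly_Mapping.keys p. survives c m' \<and> monom_image c m' = monom_image c m} =
      (if m \<in> Poly_Mapping.keys p then {m} else {})"
    using assms by auto
  then show ?thesis by (simp add: lookup_label_hom in_keys_iff)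
qed

section \<open>Monomials with the same image\<close>

text \<open>The exponent of \<open>t\<^sub>v\<close> counts both variables at \<open>v\<close>.\<close>

lemma lookup_monom_image_even:
  "Poly_Mapping.lookup (monom_image c m) (2 * v) =
    Poly_Mapping.lookup m (XVar v) + Poly_Mapping.lookup m (YVar v)"
proof -
  have "Poly_Mapping.lookup (var_image c z e) (2 * v) = (if z \<in> {XVar v, YVar v} then e else 0)" for z e
    by (cases z) (auto simp: lookup_add lookup_single_nat Suc_double_not_eq_double)
  then have "Poly_Mapping.lookup (monom_image c m) (2 * v) =
      (\<Sum>z\<in>Poly_Mapping.keys m. if z \<in> {XVar v, YVar v} then Poly_Mapping.lookup m z else 0)"
    by (simp add: monom_image_def lookup_sum)
  also have "\<dots> = (\<Sum>z\<in>Poly_Mapping.keys m \<inter> {XVar v, YVar v}. Poly_Mapping.lookup m z)"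
    by (subst sum.inter_restrict) auto
  also have "\<dots> = (\<Sum>z\<in>{XVar v, YVar v}. Poly_Mapping.lookup m z)"
    by (rule sum.mono_neutral_left) (auto simp: in_keys_iff)
  finally show ?thesis by simp
qed

text \<open>
  Monomials with the same image have the same total exponent at every vertex, so they can differ only
  in how it splits between \<open>x\<^sub>v\<close> and \<open>y\<^sub>v\<close>.
\<close>

lemma distinct_same_image:
  assumes "monom_image c m = monom_image c m'" "m \<noteq> m'"
  obtains v where "XVar v \<in> Poly_Mapping.keys m" "YVar v \<in> Poly_Mapping.keys m'"
  | v where "XVar v \<in> Poly_Mapping.keys m'" "YVar v \<in> Poly_Mapping.keys m"
proof -
  have eq: "Poly_Mapping.lookup m (XVar v) + Poly_Mapping.lookup m (YVar v) =
      Poly_Mapping.lookup m' (XVar v) + Poly_Mapping.lookup m' (YVar v)" for v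
    using assms(1) by (simp flip: lookup_monom_image_even[of c])
  obtain z where z: "Poly_Mapping.lookup m z \<noteq> Poly_Mapping.lookup m' z"
    using assms(2) by (meson poly_mapping_eqI)
  have "Poly_Mapping.lookup m (XVar (vertex z)) \<noteq> Poly_Mapping.lookup m' (XVar (vertex z))"
    using z eq[of "vertex z"] by (cases z) auto
  then show thesis
    using eq[of "vertex z"] that[of "vertex z"]
    by (cases "Poly_Mapping.lookup m (XVar (vertex z)) < Poly_Mapping.lookup m' (XVar (vertex z))")
      (auto simp: in_keys_iff)
qed

text \<open>
  As \<open>m'\<close> contains \<open>y\<^sub>v\<close>, the common image contains \<open>s\<^sub>l\<close> for the label \<open>l\<close> of \<open>v\<close>, and in \<open>m\<close> this
  factor must come from some \<open>y\<^sub>w\<close> with the same label.  So \<open>m\<close> contains \<open>x\<^sub>v y\<^sub>w\<close>, which may be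
  exchanged for \<open>x\<^sub>w y\<^sub>v\<close>: a step towards \<open>m'\<close>.
\<close>

lemma exchange_partner:
  assumes eq: "monom_image c m = monom_image c m'"
    and "XVar v \<in> Poly_Mapping.keys m" "YVar v \<in> Poly_Mapping.keys m'"
  obtains w m1 where "the (c w) = the (c v)" "m = xy v w + m1"
proof -
  obtain m1' where m1': "m' = Poly_Mapping.single (YVar v) 1 + m1'"
    using assms(3) by (rule peel_variable)
  \<comment> \<open>The index is that of the target variable \<open>s\<^sub>l\<close>.\<close>
  have "Poly_Mapping.lookup (monom_image c m) (2 * the (c v) + 1) \<noteq> 0"
    by (simp add: eq m1' monom_image_plus monom_image_single lookup_add)
  then obtain z where z: "z \<in> Poly_Mapping.keys m"
    "Poly_Mapping.lookup (var_image c z (Poly_Mapping.lookup m z)) (2 * the (c v) + 1) \<noteq> 0"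
    unfolding monom_image_def lookup_sum by (meson sum.neutral)
  have "\<exists>w. z = YVar w \<and> the (c w) = the (c v)"
  proof (cases z)
    case (XVar u)
    then show ?thesis using z(2) by (simp add: lookup_single_nat split: if_splits) presburger
  next
    case (YVar w)
    have "2 * w \<noteq> Suc (2 * the (c v))" by presburger
    with YVar show ?thesis using z(2) by (simp add: lookup_add lookup_single_nat split: if_splits)
  qed
  then obtain w where w: "z = YVar w" "the (c w) = the (c v)" by blast
  obtain m2 where m2: "m = Poly_Mapping.single (YVar w) 1 + m2"
    using z(1) w(1) by (metis peel_variable)
  then have "XVar v \<in> Poly_Mapping.keys m2"
    using assms(2) by (simp add: keys_plus_nat)
  then obtain m1 where "m2 = Poly_Mapping.single (XVar v) 1 + m1" by (rule peel_variable)
  then show thesis using that[OF w(2), of m1] m2 by (simp add: xy_def ac_simps)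
qed

lemma monom_image_xy_swap: "the (c w) = the (c v) \<Longrightarrow> monom_image c (xy v w) = monom_image c (xy w v)"
  by (simp add: xy_def monom_image_plus monom_image_single algebra_simps)

text \<open>
  In degree two a single exchange uses up the whole monomial.
\<close>

lemma fibre_degree_two_aux:
  assumes deg: "monom_degree m \<le> 2" "monom_degree m' \<le> 2"
    and eq: "monom_image c m = monom_image c m'" and "m \<noteq> m'"
    and X: "XVar v \<in> Poly_Mapping.keys m" and Y: "YVar v \<in> Poly_Mapping.keys m'"
  obtains w where "v \<noteq> w" "the (c v) = the (c w)" "m = xy v w" "m' = xy w v"
proof -
  obtain w m1 where w: "the (c w) = the (c v)" "m = xy v w + m1"
    using exchange_partner[OF eq X Y] .
  with deg(1) have m: "m = xy v w"
    by (simp add: monom_degree_plus monom_degree_xy monom_degree_0_iff)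
  obtain m1' where m1': "m' = Poly_Mapping.single (YVar v) 1 + m1'"
    using Y by (rule peel_variable)
  have "monom_image c (Poly_Mapping.single (XVar w) 1 + Poly_Mapping.single (YVar v) 1) =
      monom_image c (Poly_Mapping.single (YVar v) 1 + m1')"
    using eq monom_image_xy_swap[OF w(1)] by (simp add: m m1' xy_def)
  then have eq': "monom_image c (Poly_Mapping.single (XVar w) 1) = monom_image c m1'"
    by (metis monom_image_plus add.commute add_left_cancel)
  \<comment> \<open>A monomial of degree one leaves no room for an exchange, so it is alone in its fibre.\<close>
  have "m1' = Poly_Mapping.single (XVar w) 1"
  proof (rule ccontr)
    assume "m1' \<noteq> Poly_Mapping.single (XVar w) 1"
    from eq' this[symmetric] show False
    proof (cases rule: distinct_same_image)
      case (1 u)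
      obtain x m2 where "Poly_Mapping.single (XVar w) 1 = xy u x + m2"
        using exchange_partner[OF eq' 1] .
      then have "monom_degree (Poly_Mapping.single (XVar w) 1) = monom_degree (xy u x + m2)" by simp
      then show ?thesis by (simp add: monom_degree_single monom_degree_plus monom_degree_xy)
    qed simp
  qed
  then have m': "m' = xy w v" by (simp add: m1' xy_def add.commute)
  show thesis using that[of w] w m m' \<open>m \<noteq> m'\<close> by auto
qed

lemma fibre_degree_two:
  assumes "monom_degree m \<le> 2" "monom_degree m' \<le> 2"
    and "monom_image c m = monom_image c m'" and "m \<noteq> m'"
  obtains v w where "v \<noteq> w" "the (c v) = the (c w)" "m = xy v w" "m' = xy w v"
  using assms(3,4)
proof (cases rule: distinct_same_image)
  case (1 v)
  then show ?thesis using fibre_degree_two_aux[OF assms] that by metis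
next
  case (2 v)
  then show ?thesis
    using fibre_degree_two_aux[OF assms(2,1) assms(3,4)[symmetric], of v] that by metis
qed

section \<open>The ideal of all two-minors as a toric ideal\<close>

abbreviation whole :: "nat \<Rightarrow> nat option"
  where "whole \<equiv> \<lambda>_. Some 0"

text \<open>
  Modulo the minors, \<open>x\<^sub>v y\<^sub>w\<close> may be replaced by \<open>x\<^sub>w y\<^sub>v\<close>.  One exchange gives \<open>m\<close> and \<open>m'\<close> a common
  variable; dividing it out lowers the degree.
\<close>

lemma same_image_congruent:
  fixes I :: "(nat xy_var, 'k::field) mpoly set"
  assumes I: "ideal I (poly_ring (xy_vars G))"
    and minors: "\<And>u v. u \<in> fst G \<Longrightarrow> v \<in> fst G \<Longrightarrow> minor u v \<in> I"
    and "Poly_Mapping.keys m \<subseteq> xy_vars G" "Poly_Mapping.keys m' \<subseteq> xy_vars G"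
    and "monom_image whole m = monom_image whole m'"
  shows "Poly_Mapping.single m 1 - Poly_Mapping.single m' 1 \<in> I"
  using assms(3-5)
proof (induction "monom_degree m + monom_degree m'" arbitrary: m m' rule: less_induct)
  case less
  have step: "Poly_Mapping.single m 1 - Poly_Mapping.single m' 1 \<in> I"
    if X: "XVar v \<in> Poly_Mapping.keys m" and Y: "YVar v \<in> Poly_Mapping.keys m'"
      and eq: "monom_image whole m = monom_image whole m'"
      and V: "Poly_Mapping.keys m \<subseteq> xy_vars G" "Poly_Mapping.keys m' \<subseteq> xy_vars G"
      and IH: "\<And>n n'. monom_degree n + monom_degree n' < monom_degree m + monom_degree m' \<Longrightarrow>
        Poly_Mapping.keys n \<subseteq> xy_vars G \<Longrightarrow> Poly_Mapping.keys n' \<subseteq> xy_vars G \<Longrightarrow>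
        monom_image whole n = monom_image whole n' \<Longrightarrow>
        Poly_Mapping.single n 1 - Poly_Mapping.single n' 1 \<in> I"
    for v and m m' :: "nat xy_var \<Rightarrow>\<^sub>0 nat"
  proof -
    obtain w m1 where m: "m = xy v w + m1" using exchange_partner[OF eq X Y] .
    obtain m1' where m': "m' = Poly_Mapping.single (YVar v) 1 + m1'"
      using Y by (rule peel_variable)
    \<comment> \<open>What is left of \<open>m\<close> after exchanging \<open>x\<^sub>v y\<^sub>w\<close> for \<open>x\<^sub>w y\<^sub>v\<close> and dividing by \<open>y\<^sub>v\<close>.\<close>
    define m2 where "m2 = Poly_Mapping.single (XVar w) 1 + m1"
    have vw: "v \<in> fst G" "w \<in> fst G" and keys: "Poly_Mapping.keys m1 \<subseteq> xy_vars G"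
      "Poly_Mapping.keys m2 \<subseteq> xy_vars G" "Poly_Mapping.keys m1' \<subseteq> xy_vars G"
      using V by (auto simp: m m' m2_def keys_plus_nat keys_xy)
    have "monom_image whole (Poly_Mapping.single (YVar v) 1 + m2) = monom_image whole (xy w v + m1)"
      by (simp add: m2_def xy_def ac_simps)
    also have "\<dots> = monom_image whole (Poly_Mapping.single (YVar v) 1 + m1')"
      using eq monom_image_xy_swap[of whole w v] by (simp add: m m' monom_image_plus)
    finally have "monom_image whole m2 = monom_image whole m1'"
      by (simp add: monom_image_plus)
    then have "Poly_Mapping.single m2 1 - Poly_Mapping.single m1' 1 \<in> I"
      by (intro IH keys) (auto simp: m m' m2_def monom_degree_plus monom_degree_xy monom_degree_single)
    then have "var (YVar v) * (Poly_Mapping.single m2 1 - Poly_Mapping.single m1' 1) \<in> I"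
      using vw by (intro ideal_poly_mult[OF I] var_in_carrier) auto
    moreover have "Poly_Mapping.single m1 1 * minor v w \<in> I"
      by (intro ideal_poly_mult[OF I] minors vw carrier_single keys)
    ultimately have "Poly_Mapping.single m1 1 * minor v w +
        var (YVar v) * (Poly_Mapping.single m2 1 - Poly_Mapping.single m1' 1) \<in> I"
      by (intro ideal_poly_add[OF I])
    moreover have "Poly_Mapping.single m1 1 * minor v w +
        var (YVar v) * (Poly_Mapping.single m2 1 - Poly_Mapping.single m1' 1) =
        (Poly_Mapping.single m 1 - Poly_Mapping.single m' 1 :: (nat xy_var, 'k) mpoly)"
      by (simp add: minor_eq var_def m m' m2_def right_diff_distrib mult_single xy_def ac_simps)
    ultimately show ?thesis by simp
  qed
  show ?case
  proof (cases "m = m'")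
    case True
    then show ?thesis by (simp add: ideal_poly_zero[OF I])
  next
    case False
    with less.prems(3) show ?thesis
    proof (cases rule: distinct_same_image)
      case (1 v)
      then show ?thesis by (rule step[OF _ _ less.prems(3,1,2) less.hyps])
    next
      case (2 v)
      have "Poly_Mapping.single m' 1 - Poly_Mapping.single m 1 \<in> I"
        using 2 less.prems(3)[symmetric] less.prems(2,1)
        by (rule step[OF _ _ _ _ _ less.hyps]) (simp add: add.commute)
      then show ?thesis using ideal_poly_uminus[OF I] by fastforce
    qed
  qed
qed

text \<open>
  Replacing each monomial by a representative of its fibre changes a polynomial only by an element
  of \<open>I\<close>.  Then the coefficients over each fibre add up, and their sum is a coefficient of the image,
  which is \<open>0\<close>.
\<close>

lemma kernel_generated_by_minors:
  fixes I :: "(nat xy_var, 'k::field) mpoly set"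
  assumes I: "ideal I (poly_ring (xy_vars G))"
    and minors: "\<And>u v. u \<in> fst G \<Longrightarrow> v \<in> fst G \<Longrightarrow> minor u v \<in> I"
    and g: "g \<in> carrier (poly_ring (xy_vars G))" and ker: "label_hom whole g = 0"
  shows "g \<in> I"
proof -
  define nf where "nf M = (SOME m. Poly_Mapping.keys m \<subseteq> xy_vars G \<and> monom_image whole m = M)" for M
  let ?K = "Poly_Mapping.keys g"
  let ?c = "Poly_Mapping.lookup g"
  have nf: "Poly_Mapping.keys (nf (monom_image whole m)) \<subseteq> xy_vars G \<and>
      monom_image whole (nf (monom_image whole m)) = monom_image whole m" if "m \<in> ?K" for m
    unfolding nf_def by (rule someI[of _ m]) (use g that in \<open>auto simp: in_carrier_poly_ring\<close>)
  have "Poly_Mapping.single m (?c m) - Poly_Mapping.single (nf (monom_image whole m)) (?c m) \<in> I"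
    if "m \<in> ?K" for m
  proof -
    have "Poly_Mapping.single m 1 - Poly_Mapping.single (nf (monom_image whole m)) 1 \<in> I"
      using nf[OF that] g that by (intro same_image_congruent[OF I minors]) (auto simp: in_carrier_poly_ring)
    then have "Poly_Mapping.single 0 (?c m) *
        (Poly_Mapping.single m 1 - Poly_Mapping.single (nf (monom_image whole m)) 1) \<in> I"
      by (intro ideal_poly_mult[OF I] carrier_single) auto
    then show ?thesis by (simp add: right_diff_distrib mult_single)
  qed
  then have "(\<Sum>m\<in>?K. Poly_Mapping.single m (?c m) - Poly_Mapping.single (nf (monom_image whole m)) (?c m)) \<in> I"
    by (rule ideal_poly_sum[OF I])
  moreover have "(\<Sum>m\<in>?K. Poly_Mapping.single (nf (monom_image whole m)) (?c m)) = 0"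
  proof -
    have "(\<Sum>m\<in>?K. Poly_Mapping.single (nf (monom_image whole m)) (?c m)) =
        (\<Sum>M\<in>monom_image whole ` ?K. \<Sum>m\<in>{m \<in> ?K. monom_image whole m = M}.
          Poly_Mapping.single (nf (monom_image whole m)) (?c m))"
      by (rule sum.image_gen) simp
    also have "\<dots> = (\<Sum>M\<in>monom_image whole ` ?K.
        Poly_Mapping.single (nf M) (Poly_Mapping.lookup (label_hom whole g) M))"
      by (intro sum.cong) (auto simp: lookup_label_hom survives_def simp flip: sum_single)
    finally show ?thesis by (simp add: ker)
  qed
  ultimately show ?thesis by (simp add: sum_subtractf flip: poly_as_sum)
qed

section \<open>Binomial edge ideals\<close>

lemma binomial_edge_ideal_eq:
  "binomial_edge_ideal G = Idl\<^bsub>poly_ring (xy_vars G)\<^esub> {minor u v | u v. {u, v} \<in> snd G}"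
  by (simp add: binomial_edge_ideal_def minor_def)

lemma colon_ideal_mem_iff:
  "g \<in> colon (poly_ring V) I f \<longleftrightarrow> g \<in> carrier (poly_ring V) \<and> g * f \<in> I"
  by (simp add: colon_def)

text \<open>
  Natural numbers as vertices fit the encoding of target variables of \<^const>\<open>label_hom\<close>.
\<close>

locale edge_ideal =
  fixes G :: "nat graph" and J :: "(nat xy_var, 'k::field) mpoly set"
  assumes edge_vertices: "{u, v} \<in> snd G \<Longrightarrow> u \<in> fst G"
    and J_def: "J = binomial_edge_ideal G"
begin

abbreviation R :: "(nat xy_var, 'k) mpoly ring"
  where "R \<equiv> poly_ring (xy_vars G)"

definition compatible :: "(nat \<Rightarrow> nat option) \<Rightarrow> bool"
  where "compatible c \<longleftrightarrow> (\<forall>u v. {u, v} \<in> snd G \<longrightarrow> c u = None \<or> c v = None \<or> c u = c v)"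

lemma edge_vertices': "{u, v} \<in> snd G \<Longrightarrow> v \<in> fst G"
  using edge_vertices[of v u] by (simp add: insert_commute)

lemma generators_in_carrier: "{minor u v | u v. {u, v} \<in> snd G} \<subseteq> carrier R"
  by (auto intro: minor_in_carrier dest: edge_vertices edge_vertices')

lemma J_ideal: "ideal J R"
  unfolding J_def binomial_edge_ideal_eq
  using ring.genideal_ideal[OF cring.axioms(1)[OF cring_poly_ring] generators_in_carrier] .

lemma edge_minor_in_J: "{u, v} \<in> snd G \<Longrightarrow> minor u v \<in> J"
  unfolding J_def binomial_edge_ideal_eq
  using ring.genideal_self[OF cring.axioms(1)[OF cring_poly_ring] generators_in_carrier]
  by (auto simp: subset_iff)

lemma J_in_kernel:
  assumes "compatible c" "p \<in> J"
  shows "label_hom c p = 0"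
proof -
  have "{minor u v | u v. {u, v} \<in> snd G} \<subseteq> {p \<in> carrier R. label_hom c p = 0}"
    using generators_in_carrier assms(1)
    unfolding compatible_def by (fastforce simp: label_hom_minor_eq_0_iff)
  then have "J \<subseteq> {p \<in> carrier R. label_hom c p = 0}"
    unfolding J_def binomial_edge_ideal_eq
    by (intro ring.genideal_minimal[OF cring.axioms(1)[OF cring_poly_ring]]
        primeideal.axioms(1)[OF prime_kernel])
  with assms(2) show ?thesis by blast
qed

text \<open>The kernel is prime and contains \<open>P f\<close>, as it contains \<open>J\<close>.\<close>

lemma kernel_dichotomy:
  assumes "compatible c" "colon R J f = P"
  shows "label_hom c f = 0 \<or> (\<forall>g\<in>P. label_hom c g = 0)"
proof -
  have "label_hom c g * label_hom c f = 0" if "g \<in> P" for g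
  proof -
    have "g * f \<in> J" using that assms(2) by (auto simp: colon_ideal_mem_iff)
    from J_in_kernel[OF assms(1) this] show ?thesis by (simp add: label_hom_mult)
  qed
  then show ?thesis by auto
qed

text \<open>
  Otherwise \<open>P\<close> lies in both kernels.  But \<open>x\<^sub>w f\<^sub>u\<^sub>v \<in> J \<subseteq> P\<close>, while \<open>x\<^sub>w\<close> is not in the first kernel
  and \<open>f\<^sub>u\<^sub>v\<close> is not in the second one.
\<close>

lemma in_one_of_two_kernels:
  assumes P: "primeideal P R" "colon R J f = P" and f: "f \<in> carrier R"
    and c: "compatible c" "c w \<noteq> None" and c': "compatible c'" "label_hom c' (minor u v :: (nat xy_var, 'k) mpoly) \<noteq> 0"
    and path: "{w, u} \<in> snd G" "{w, v} \<in> snd G"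
  shows "label_hom c f = 0 \<or> label_hom c' f = 0"
proof (rule ccontr)
  assume "\<not> ?thesis"
  then have ker: "\<And>g. g \<in> P \<Longrightarrow> label_hom c g = 0" "\<And>g. g \<in> P \<Longrightarrow> label_hom c' g = 0"
    using kernel_dichotomy[OF c(1) P(2)] kernel_dichotomy[OF c'(1) P(2)] by auto
  have V: "w \<in> fst G" "u \<in> fst G" "v \<in> fst G"
    using edge_vertices[OF path(1)] edge_vertices'[OF path(1)] edge_vertices'[OF path(2)] by auto
  have "1 * 1 * var (XVar w) * minor u v \<in> J"
    using path[THEN edge_minor_in_J]
    by (intro minor_chain[OF J_ideal V(2,3)]) (auto simp: in_carrier_poly_ring)
  then have "f * (var (XVar w) * minor u v) \<in> J"
    using f by (simp add: ideal_poly_mult[OF J_ideal])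
  moreover have carr: "var (XVar w) \<in> carrier R" "minor u v \<in> carrier R"
    using V by (simp_all add: var_in_carrier minor_in_carrier)
  ultimately have "var (XVar w) * minor u v \<in> P"
    by (simp add: P(2)[symmetric] colon_ideal_mem_iff carrier_mult mult.commute)
  then have "var (XVar w) \<in> P \<or> minor u v \<in> P"
    using primeideal.I_prime[OF P(1) carr] by simp
  moreover have "label_hom c (var (XVar w) :: (nat xy_var, 'k) mpoly) \<noteq> 0"
  proof -
    have "Poly_Mapping.keys (label_hom c (var (XVar w) :: (nat xy_var, 'k) mpoly)) \<noteq> {}"
      using c(2) by (simp add: var_def label_hom_single survives_def)
    then show ?thesis by auto
  qed
  ultimately show False using ker c'(2) by blast
qed

end

section \<open>Crown graphs\<close>

definition left :: "nat \<Rightarrow> nat" where "left i = 2 * i - 1"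
definition right :: "nat \<Rightarrow> nat" where "right i = 2 * i"

lemma left_right_simps [simp]:
  "i \<ge> 1 \<Longrightarrow> j \<ge> 1 \<Longrightarrow> left i = left j \<longleftrightarrow> i = j"
  "right i = right j \<longleftrightarrow> i = j"
  "i \<ge> 1 \<Longrightarrow> left i \<noteq> right j" "i \<ge> 1 \<Longrightarrow> right j \<noteq> left i"
  "i \<ge> 1 \<Longrightarrow> odd (left i)" "even (right j)"
  unfolding left_def right_def by presburger+

text \<open>Keeps four vertices, which span the two disjoint edges \<open>a\<^sub>i b\<^sub>j\<close> and \<open>a\<^sub>j b\<^sub>i\<close>.\<close>

definition pair_labelling :: "nat \<Rightarrow> nat \<Rightarrow> nat \<Rightarrow> nat option"
  where "pair_labelling i j v =
    (if v = left i \<or> v = right j then Some 0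
     else if v = left j \<or> v = right i then Some 1 else None)"

text \<open>
  Without one side of the bipartition every vertex of the other side is isolated, hence a component
  of its own.
\<close>

definition left_labelling :: "nat \<Rightarrow> nat option"
  where "left_labelling v = (if odd v then Some v else None)"

definition right_labelling :: "nat \<Rightarrow> nat option"
  where "right_labelling v = (if even v then Some v else None)"

locale crown = edge_ideal "crown_graph n" J for n :: nat and J :: "(nat xy_var, 'k::field) mpoly set" +
  assumes n: "n \<ge> 4"

lemma crown_graph_vertices: "fst (crown_graph n) = {1..2 * n}"
  by (simp add: crown_graph_def)

lemma crown_graph_edge_iff:
  "{u, v} \<in> snd (crown_graph n) \<longleftrightarrow> (\<exists>i\<in>{1..n}. \<exists>j\<in>{1..n}. i \<noteq> j \<and>
    (u = left i \<and> v = right j \<or> u = right j \<and> v = left i))"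
  unfolding crown_graph_def left_def right_def snd_conv mem_Collect_eq doubleton_eq_iff
  by (rule iffI, (elim exE conjE disjE; force), elim bexE conjE, blast)

lemma left_vertex: "i \<in> {1..n} \<Longrightarrow> left i \<in> {1..2 * n}"
  and right_vertex: "i \<in> {1..n} \<Longrightarrow> right i \<in> {1..2 * n}"
  by (auto simp: left_def right_def)

lemma crown_vertex_cases:
  assumes "v \<in> {1..2 * n}"
  obtains i where "i \<in> {1..n}" "v = left i" | i where "i \<in> {1..n}" "v = right i"
proof (cases "odd v")
  case True
  then obtain k where "v = 2 * k + 1" by (rule oddE)
  then have "v = left (Suc k)" "Suc k \<in> {1..n}" using assms by (auto simp: left_def)
  then show thesis using that(1) by blast
next
  case False
  then obtain k where "v = 2 * k" by (meson evenE)
  then have "v = right k" "k \<in> {1..n}" using assms by (auto simp: right_def)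
  then show thesis using that(2) by blast
qed

lemma edge_ideal_crown:
  "J = binomial_edge_ideal (crown_graph n) \<Longrightarrow> edge_ideal (crown_graph n) J"
  by unfold_locales (auto simp: crown_graph_vertices crown_graph_edge_iff left_def right_def)

context crown
begin

lemma left_right_edge:
  "i \<in> {1..n} \<Longrightarrow> j \<in> {1..n} \<Longrightarrow> i \<noteq> j \<Longrightarrow> {left i, right j} \<in> snd (crown_graph n)"
  "i \<in> {1..n} \<Longrightarrow> j \<in> {1..n} \<Longrightarrow> i \<noteq> j \<Longrightarrow> {right j, left i} \<in> snd (crown_graph n)"
  unfolding crown_graph_edge_iff by blast+

lemma compatible_labellings:
  "compatible whole" "compatible left_labelling" "compatible right_labelling"
  "i \<in> {1..n} \<Longrightarrow> j \<in> {1..n} \<Longrightarrow> compatible (pair_labelling i j)"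
  unfolding compatible_def crown_graph_edge_iff
  by (auto simp: left_labelling_def right_labelling_def pair_labelling_def)

subsection \<open>Lower bound\<close>

text \<open>
  The index \<open>k\<close> supplies the middle vertex of a path \<open>b\<^sub>i - a\<^sub>k - b\<^sub>j\<close> or \<open>a\<^sub>i - b\<^sub>k - a\<^sub>j\<close> whose ends the
  pair labelling separates.
\<close>

lemma kernels_of_colon:
  assumes P: "primeideal P R" "colon R J f = P" "f \<in> carrier R"
    and ij: "i \<in> {1..n}" "j \<in> {1..n}" "i \<noteq> j"
    and k: "k \<in> {1..n}" "k \<noteq> i" "k \<noteq> j"
    and c: "compatible c" "c (left k) \<noteq> None \<or> c (right k) \<noteq> None"
  shows "label_hom c f = 0 \<or> label_hom (pair_labelling i j) f = 0"
  using c(2)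
proof
  assume "c (left k) \<noteq> None"
  then show ?thesis
    using ij k left_right_edge[of k i] left_right_edge[of k j]
    by (intro in_one_of_two_kernels[OF P c(1), where u = "right i" and v = "right j" and w = "left k"])
      (auto simp: label_hom_minor_eq_0_iff pair_labelling_def compatible_labellings)
next
  assume "c (right k) \<noteq> None"
  then show ?thesis
    using ij k left_right_edge[of i k] left_right_edge[of j k]
    by (intro in_one_of_two_kernels[OF P c(1), where u = "left i" and v = "left j" and w = "right k"])
      (auto simp: label_hom_minor_eq_0_iff pair_labelling_def compatible_labellings)
qed

text \<open>A monomial of degree at most two involves at most two of the indices.\<close>

lemma survives_some_pair:
  assumes "Poly_Mapping.keys m \<subseteq> xy_vars (crown_graph n)" "monom_degree m \<le> 2"
  obtains i j where "i \<in> {1..n}" "j \<in> {1..n}" "i \<noteq> j" "survives (pair_labelling i j) m"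
proof -
  define index :: "nat xy_var \<Rightarrow> nat" where "index z = (vertex z + 1) div 2" for z
  have V: "vertex z \<in> {1..2 * n}" if "z \<in> Poly_Mapping.keys m" for z
    using assms(1) that by (cases z) (auto simp: crown_graph_vertices)
  have "card (Poly_Mapping.keys m) = (\<Sum>z\<in>Poly_Mapping.keys m. 1)" by simp
  also have "\<dots> \<le> monom_degree m"
    unfolding monom_degree_def by (rule sum_mono) (auto simp: in_keys_iff)
  finally have "card (index ` Poly_Mapping.keys m) \<le> 2"
    using assms(2) card_image_le[of "Poly_Mapping.keys m" index] by simp
  moreover have "index ` Poly_Mapping.keys m \<subseteq> {1..n}"
    using V by (fastforce simp: index_def)
  ultimately obtain T where T: "index ` Poly_Mapping.keys m \<subseteq> T" "T \<subseteq> {1..n}" "card T = 2"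
    using exists_subset_between[of "index ` Poly_Mapping.keys m" 2 "{1..n}"] n by auto
  then obtain i j where ij: "T = {i, j}" "i \<noteq> j" by (auto simp: card_2_iff)
  have "pair_labelling i j (vertex z) \<noteq> None" if z: "z \<in> Poly_Mapping.keys m" for z
  proof -
    have "index z = i \<or> index z = j" using T(1) ij z by auto
    moreover have "vertex z = left (index z) \<or> vertex z = right (index z)"
      using V[OF z] unfolding index_def left_def right_def atLeastAtMost_iff by presburger
    ultimately show ?thesis by (auto simp: pair_labelling_def)
  qed
  then show thesis using that[of i j] ij T(2) by (auto simp: survives_def)
qed

lemma third_index:
  obtains k where "k \<in> {1..n}" "k \<noteq> i" "k \<noteq> j"
proof -
  have "card {i, j} < card {1..n}" using n card_insert_le_m1[of 2 "{j}" i] by simp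
  then have "\<not> {1..n} \<subseteq> {i, j}" by (meson card_mono finite.emptyI finite_insert leD)
  then show thesis using that by blast
qed

text \<open>
  Let \<open>h\<close> be \<open>f\<close> without its terms in \<open>x\<^sub>u y\<^sub>v\<close> with \<open>u = a\<^sub>i\<close>, \<open>v = b\<^sub>j\<close>, \<open>i \<noteq> j\<close>, removed with the help of
  the generators of \<open>J\<close>.  A map that annihilates \<open>f\<close> also annihilates \<open>h\<close>.  By
  \<open>fibre_degree_two\<close>, a monomial of \<open>h\<close> that survives such a map is of the form \<open>x\<^sub>u y\<^sub>v\<close>
  with \<open>u \<noteq> v\<close> equally labelled, and its mirror \<open>x\<^sub>v y\<^sub>u\<close> occurs in \<open>h\<close> too.  Every monomial
  of \<open>h\<close> does survive such a map, namely that of \<open>T = {}\<close> or that of some pair.  Then \<open>u\<close> and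
  \<open>v\<close> are not adjacent, and there are two maps that separate them: for \<open>a\<^sub>i\<close> and \<open>a\<^sub>j\<close> the one
  that kills all \<open>b\<^sub>k\<close> and the one of the pair \<open>i, j\<close>; likewise for \<open>b\<^sub>i\<close> and \<open>b\<^sub>j\<close>; for \<open>a\<^sub>i\<close> and \<open>b\<^sub>i\<close>
  those of two pairs containing \<open>i\<close>.  One of the two annihilates \<open>f\<close>, a contradiction.
\<close>

lemma low_degree_in_J:
  assumes P: "primeideal P R" "colon R J f = P" "f \<in> carrier R"
    and deg: "\<And>m. m \<in> Poly_Mapping.keys f \<Longrightarrow> monom_degree m \<le> 2"
  shows "f \<in> J"
proof -
  define E where "E = {e \<in> {1..n} \<times> {1..n}. fst e \<noteq> snd e}"
  define e where "e p = xy (left (fst p)) (right (snd p))" for p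
  define s where "s = (\<Sum>p\<in>E. Poly_Mapping.single 0 (Poly_Mapping.lookup f (e p)) *
      minor (left (fst p)) (right (snd p)))"
  have "s \<in> J"
    unfolding s_def using left_right_edge(1)
    by (intro ideal_poly_sum[OF J_ideal] ideal_poly_mult[OF J_ideal] edge_minor_in_J carrier_single)
      (auto simp: E_def)
  have s_eq: "s = (\<Sum>p\<in>E. Poly_Mapping.single (e p) (Poly_Mapping.lookup f (e p)) -
      Poly_Mapping.single (xy (right (snd p)) (left (fst p))) (Poly_Mapping.lookup f (e p)))"
    by (simp add: s_def e_def minor_eq right_diff_distrib mult_single)
  define h where "h = f - s"
  have h_edge: "xy (left i) (right j) \<notin> Poly_Mapping.keys h" if "i \<in> {1..n}" "j \<in> {1..n}" "i \<noteq> j" for i j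
  proof -
    have ij: "(i, j) \<in> E" using that by (simp add: E_def)
    have "Poly_Mapping.lookup s (e (i, j)) =
        (\<Sum>p\<in>E. if p = (i, j) then Poly_Mapping.lookup f (e p) else 0)"
      unfolding s_eq lookup_sum
      by (rule sum.cong) (use that in \<open>auto simp: E_def e_def lookup_minus lookup_single when_def\<close>)
    also have "\<dots> = Poly_Mapping.lookup f (e (i, j))"
      using ij by (subst sum.delta) (auto simp: E_def)
    finally show ?thesis by (simp add: h_def in_keys_iff lookup_minus e_def)
  qed
  have h_deg: "monom_degree m \<le> 2" if "m \<in> Poly_Mapping.keys h" for m
  proof -
    have "Poly_Mapping.keys s \<subseteq> (\<Union>p\<in>E. Poly_Mapping.keys (Poly_Mapping.single (e p) (Poly_Mapping.lookup f (e p)) -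
      Poly_Mapping.single (xy (right (snd p)) (left (fst p))) (Poly_Mapping.lookup f (e p))))"
      unfolding s_eq by (rule Poly_Mapping.keys_sum)
    also have "\<dots> \<subseteq> {m. monom_degree m \<le> 2}"
      by (intro UN_least order_trans[OF keys_diff_subset]) (auto simp: e_def monom_degree_xy)
    finally show ?thesis
      using that deg keys_diff_subset[of f s] unfolding h_def by blast
  qed
  have h_carrier: "h \<in> carrier R"
    unfolding h_def using P(3) ideal_poly_carrier[OF J_ideal \<open>s \<in> J\<close>] by (rule carrier_diff)
  \<comment> \<open>A surviving monomial of \<open>h\<close> can cancel only against its mirror.\<close>
  have mirror: "\<exists>v w. v \<noteq> w \<and> c v = c w \<and> m = xy v w \<and> xy w v \<in> Poly_Mapping.keys h"
    if m: "m \<in> Poly_Mapping.keys h" and c: "compatible c" "survives c m" "label_hom c f = 0" for m c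
  proof -
    have "label_hom c h = 0"
      using c J_in_kernel[OF c(1) \<open>s \<in> J\<close>] by (simp add: h_def label_hom_diff)
    with m lookup_label_hom_isolated[OF c(2), of h]
    obtain m' where m': "m' \<in> Poly_Mapping.keys h" "survives c m'" "monom_image c m = monom_image c m'" "m \<noteq> m'"
      by (fastforce simp: in_keys_iff)
    obtain v w where vw: "v \<noteq> w" "the (c v) = the (c w)" "m = xy v w" "m' = xy w v"
      using fibre_degree_two[OF h_deg[OF m] h_deg[OF m'(1)] m'(3,4)] .
    moreover have "c v \<noteq> None" "c w \<noteq> None"
      using c(2) vw(3) by (auto simp: survives_def keys_xy)
    ultimately show ?thesis using m'(1) by (metis option.expand)
  qed
  have not_swapped: False
    if uv: "u \<noteq> v" "xy u v \<in> Poly_Mapping.keys h" "xy v u \<in> Poly_Mapping.keys h" for u v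
  proof -
    have V: "u \<in> {1..2 * n}" "v \<in> {1..2 * n}"
      using h_carrier uv(2) by (auto simp: in_carrier_poly_ring keys_xy crown_graph_vertices)
    \<comment> \<open>A map that separates \<open>u\<close> from \<open>v\<close> cannot annihilate \<open>f\<close>.\<close>
    have sep: "label_hom c f \<noteq> 0" if "compatible c" "c u \<noteq> None" "c v \<noteq> None" "c u \<noteq> c v" for c
      using mirror[OF uv(2) that(1)] that(2-) by (auto simp: survives_def keys_xy)
    have same: False if i: "i \<in> {1..n}" and "{u, v} = {left i, right i}" for i
    proof -
      obtain j where j: "j \<in> {1..n}" "j \<noteq> i" using third_index by metis
      obtain k where k: "k \<in> {1..n}" "k \<noteq> i" "k \<noteq> j" using third_index .
      have "label_hom (pair_labelling i k) f = 0 \<or> label_hom (pair_labelling i j) f = 0"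
        using i j k by (intro kernels_of_colon[OF P, where k = k] compatible_labellings)
          (auto simp: pair_labelling_def)
      moreover have "label_hom (pair_labelling i l) f \<noteq> 0" if "l \<in> {1..n}" "l \<noteq> i" for l
        using \<open>{u, v} = _\<close> i that
        by (intro sep compatible_labellings) (auto simp: pair_labelling_def doubleton_eq_iff)
      ultimately show False using j k by blast
    qed
    from V(1) show False
    proof (cases rule: crown_vertex_cases)
      case u: (1 i)
      from V(2) show ?thesis
      proof (cases rule: crown_vertex_cases)
        case v: (1 j)
        then have "i \<noteq> j" using u uv(1) by auto
        obtain k where k: "k \<in> {1..n}" "k \<noteq> i" "k \<noteq> j" using third_index .
        have "label_hom left_labelling f = 0 \<or> label_hom (pair_labelling i j) f = 0"
          using u v k \<open>i \<noteq> j\<close> by (intro kernels_of_colon[OF P, where k = k] compatible_labellings)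
            (auto simp: left_labelling_def)
        moreover have "label_hom left_labelling f \<noteq> 0" "label_hom (pair_labelling i j) f \<noteq> 0"
          using u v \<open>i \<noteq> j\<close>
          by (intro sep compatible_labellings; auto simp: left_labelling_def pair_labelling_def)+
        ultimately show ?thesis by blast
      next
        case v: (2 j)
        then show ?thesis using u same[of i] h_edge[of i j] uv(2) by (cases "i = j") auto
      qed
    next
      case u: (2 i)
      from V(2) show ?thesis
      proof (cases rule: crown_vertex_cases)
        case v: (1 j)
        then show ?thesis using u same[of i] h_edge[of j i] uv(3) by (cases "i = j") auto
      next
        case v: (2 j)
        then have "i \<noteq> j" using u uv(1) by auto
        obtain k where k: "k \<in> {1..n}" "k \<noteq> i" "k \<noteq> j" using third_index .
        have "label_hom right_labelling f = 0 \<or> label_hom (pair_labelling i j) f = 0"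
          using u v k \<open>i \<noteq> j\<close> by (intro kernels_of_colon[OF P, where k = k] compatible_labellings)
            (auto simp: right_labelling_def)
        moreover have "label_hom right_labelling f \<noteq> 0" "label_hom (pair_labelling i j) f \<noteq> 0"
          using u v \<open>i \<noteq> j\<close>
          by (intro sep compatible_labellings; auto simp: right_labelling_def pair_labelling_def)+
        ultimately show ?thesis by blast
      qed
    qed
  qed
  have "m \<notin> Poly_Mapping.keys h" for m
  proof
    assume m: "m \<in> Poly_Mapping.keys h"
    then have "Poly_Mapping.keys m \<subseteq> xy_vars (crown_graph n)"
      using h_carrier by (auto simp: in_carrier_poly_ring)
    then obtain i j where ij: "i \<in> {1..n}" "j \<in> {1..n}" "i \<noteq> j" "survives (pair_labelling i j) m"
      using h_deg[OF m] by (rule survives_some_pair)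
    obtain k where k: "k \<in> {1..n}" "k \<noteq> i" "k \<noteq> j" using third_index .
    have "label_hom whole f = 0 \<or> label_hom (pair_labelling i j) f = 0"
      using ij k by (intro kernels_of_colon[OF P, where k = k] compatible_labellings) auto
    moreover have "survives whole m" by (simp add: survives_def)
    ultimately obtain v w where "v \<noteq> w" "m = xy v w" "xy w v \<in> Poly_Mapping.keys h"
      using mirror[OF m] ij compatible_labellings by metis
    then show False using not_swapped m by blast
  qed
  then have "h = 0" by (metis all_not_in_conv keys_eq_empty)
  with \<open>s \<in> J\<close> show ?thesis by (simp add: h_def)
qed

lemma v_number_lower_bound: "3 \<le> v_number (xy_vars (crown_graph n)) J"
proof -
  have "3 \<le> d" if P: "P \<in> Ass R J" and f: "f \<in> hom_component (xy_vars (crown_graph n)) d" "colon R J f = P"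
    for P f d
  proof (rule ccontr)
    assume "\<not> 3 \<le> d"
    with f(1) have "f \<in> carrier R" "\<And>m. m \<in> Poly_Mapping.keys f \<Longrightarrow> monom_degree m \<le> 2"
      by (auto simp: hom_component_def)
    moreover have prime: "primeideal P R" using P by (simp add: Ass_def)
    ultimately have "f \<in> J" using low_degree_in_J f(2) by blast
    then have "1 \<in> P"
      by (auto simp: f(2)[symmetric] colon_ideal_mem_iff in_carrier_poly_ring)
    then show False
      using ideal.one_imp_carrier[OF primeideal.axioms(1)[OF prime]] primeideal.I_notcarr[OF prime] by simp
  qed
  then have "3 \<le> enat d" if "P \<in> Ass R J" "f \<in> hom_component (xy_vars (crown_graph n)) d" "colon R J f = P"
    for P f d
    using that by (metis enat_ord_simps(1) numeral_eq_enat)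
  then show ?thesis
    unfolding v_number_def local_v_number_def by (intro Inf_greatest) (auto intro!: Inf_greatest)
qed

subsection \<open>Upper bound\<close>

abbreviation x :: "nat \<Rightarrow> (nat xy_var, 'k) mpoly"
  where "x v \<equiv> var (XVar v)"

text \<open>
  Each kernel used for the lower bound, except that of \<open>T = {}\<close>, contains one of these four
  variables.  In particular the complement of \<open>{a\<^sub>i, b\<^sub>i, a\<^sub>j, b\<^sub>j}\<close> contains one of the four
  vertices, because these have four different indices; this is where \<open>n \<ge> 4\<close> enters.
\<close>

definition witness :: "(nat xy_var, 'k) mpoly"
  where "witness = x (left 1) * x (left 2) * x (right 3) * x (right 4)"

lemma x_in_carrier:
  "i \<in> {1..n} \<Longrightarrow> x (left i) \<in> carrier R" "i \<in> {1..n} \<Longrightarrow> x (right i) \<in> carrier R"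
  using left_vertex right_vertex by (auto simp: crown_graph_vertices intro!: var_in_carrier)

lemma witness_in_carrier: "witness \<in> carrier R"
  unfolding witness_def using n by (intro carrier_mult x_in_carrier) auto

text \<open>
  Here \<open>q\<close> is the product of the \<open>x\<close>-variables at the inner vertices of a path from \<open>w\<close> to \<open>v\<close>, which the
  edge from \<open>w\<close> to \<open>u\<close> prolongs.
\<close>

lemma extend_path:
  assumes "{w, u} \<in> snd (crown_graph n)" "v \<in> {1..2 * n}" "q \<in> carrier R" "q * minor w v \<in> J"
  shows "q * x w * minor u v \<in> J"
proof -
  have "1 * q * x w * minor u v \<in> J"
    using assms edge_minor_in_J[OF assms(1)] edge_vertices'[OF assms(1)]
    by (intro minor_chain[OF J_ideal]) (auto simp: crown_graph_vertices in_carrier_poly_ring)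
  then show ?thesis by simp
qed

lemma mult_minor_swap: "q * minor u v \<in> J \<Longrightarrow> q * minor v u \<in> J"
  using ideal_poly_uminus[OF J_ideal, of "q * minor u v"] by (simp add: minor_swap[of v u])

lemma two_step_path:
  assumes "{w, u} \<in> snd (crown_graph n)" "{w, v} \<in> snd (crown_graph n)"
  shows "x w * minor u v \<in> J"
  using extend_path[OF assms(1), of v 1] edge_minor_in_J[OF assms(2)] edge_vertices'[OF assms(2)]
  by (simp add: crown_graph_vertices in_carrier_poly_ring)

lemma witness_multiple:
  assumes "t * minor u v \<in> J" "r \<in> carrier R" and eq: "witness = r * t"
  shows "minor u v * witness \<in> J"
  using ideal_poly_mult[OF J_ideal assms(1,2)] unfolding eq by (simp add: ac_simps)

lemma small_indices: "1 \<in> {1..n}" "2 \<in> {1..n}" "3 \<in> {1..n}" "4 \<in> {1..n}"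
  using n by auto

text \<open>
  If \<open>{i, j} \<noteq> {3, 4}\<close>, then \<open>b\<^sub>3\<close> or \<open>b\<^sub>4\<close> is a common neighbour of \<open>a\<^sub>i\<close> and \<open>a\<^sub>j\<close>.  Otherwise the path
  \<open>a\<^sub>i - b\<^sub>j - a\<^sub>1 - b\<^sub>i - a\<^sub>j\<close> does it.
\<close>

lemma minor_left_left:
  assumes ij: "i \<in> {1..n}" "j \<in> {1..n}" "i \<noteq> j"
  shows "minor (left i) (left j) * witness \<in> J"
proof -
  consider "3 \<notin> {i, j}" | "4 \<notin> {i, j}" | "{i, j} = {3, 4}" using ij by fastforce
  then show ?thesis
  proof cases
    case 1
    then have "x (right 3) * minor (left i) (left j) \<in> J"
      using ij small_indices by (intro two_step_path left_right_edge) auto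
    then show ?thesis
      by (rule witness_multiple[where r = "x (left 1) * x (left 2) * x (right 4)"])
        (use n in \<open>auto simp: witness_def ac_simps intro!: carrier_mult x_in_carrier\<close>)
  next
    case 2
    then have "x (right 4) * minor (left i) (left j) \<in> J"
      using ij small_indices by (intro two_step_path left_right_edge) auto
    then show ?thesis
      by (rule witness_multiple[where r = "x (left 1) * x (left 2) * x (right 3)"])
        (use n in \<open>auto simp: witness_def ac_simps intro!: carrier_mult x_in_carrier\<close>)
  next
    case 3
    then have ne: "i \<noteq> 1" "j \<noteq> 1" by (auto simp: doubleton_eq_iff)
    have "x (left 1) * minor (right i) (right j) \<in> J"
      using ij ne small_indices by (intro two_step_path left_right_edge) auto
    then have "x (left 1) * x (right i) * minor (left j) (right j) \<in> J"
      using ij small_indices x_in_carrier right_vertex by (intro extend_path left_right_edge) auto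
    then have "x (left 1) * x (right i) * minor (right j) (left j) \<in> J"
      by (rule mult_minor_swap)
    then have "x (left 1) * x (right i) * x (right j) * minor (left i) (left j) \<in> J"
      using ij small_indices x_in_carrier
      by (intro extend_path[OF left_right_edge(2) left_vertex carrier_mult]) auto
    then show ?thesis
      by (rule witness_multiple[where r = "x (left 2)"])
        (use 3 n in \<open>auto simp: witness_def ac_simps doubleton_eq_iff intro!: x_in_carrier\<close>)
  qed
qed

text \<open>
  The mirror image, with the path \<open>b\<^sub>i - a\<^sub>j - b\<^sub>3 - a\<^sub>i - b\<^sub>j\<close> if \<open>{i, j} = {1, 2}\<close>.
\<close>

lemma minor_right_right:
  assumes ij: "i \<in> {1..n}" "j \<in> {1..n}" "i \<noteq> j"
  shows "minor (right i) (right j) * witness \<in> J"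
proof -
  consider "1 \<notin> {i, j}" | "2 \<notin> {i, j}" | "{i, j} = {1, 2}" using ij by fastforce
  then show ?thesis
  proof cases
    case 1
    then have "x (left 1) * minor (right i) (right j) \<in> J"
      using ij small_indices by (intro two_step_path left_right_edge) auto
    then show ?thesis
      by (rule witness_multiple[where r = "x (left 2) * x (right 3) * x (right 4)"])
        (use n in \<open>auto simp: witness_def ac_simps intro!: carrier_mult x_in_carrier\<close>)
  next
    case 2
    then have "x (left 2) * minor (right i) (right j) \<in> J"
      using ij small_indices by (intro two_step_path left_right_edge) auto
    then show ?thesis
      by (rule witness_multiple[where r = "x (left 1) * x (right 3) * x (right 4)"])
        (use n in \<open>auto simp: witness_def ac_simps intro!: carrier_mult x_in_carrier\<close>)
  next
    case 3
    then have ne: "i \<noteq> 3" "j \<noteq> 3" by (auto simp: doubleton_eq_iff)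
    have "x (right 3) * minor (left i) (left j) \<in> J"
      using ij ne small_indices by (intro two_step_path left_right_edge) auto
    then have "x (right 3) * x (left i) * minor (right j) (left j) \<in> J"
      using ij small_indices x_in_carrier left_vertex by (intro extend_path left_right_edge) auto
    then have "x (right 3) * x (left i) * minor (left j) (right j) \<in> J"
      by (rule mult_minor_swap)
    then have "x (right 3) * x (left i) * x (left j) * minor (right i) (right j) \<in> J"
      using ij small_indices x_in_carrier
      by (intro extend_path[OF left_right_edge(1) right_vertex carrier_mult]) auto
    then show ?thesis
      by (rule witness_multiple[where r = "x (right 4)"])
        (use 3 n in \<open>auto simp: witness_def ac_simps doubleton_eq_iff intro!: x_in_carrier\<close>)
  qed
qed

text \<open>
  The only case without an edge is \<open>i = j\<close>.  There the path is \<open>a\<^sub>i - b\<^sub>l - a\<^sub>k - b\<^sub>i\<close> with \<open>k\<close> in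
  \<open>{1, 2}\<close> and \<open>l\<close> in \<open>{3, 4}\<close>, both different from \<open>i\<close>.
\<close>

lemma minor_left_right:
  assumes ij: "i \<in> {1..n}" "j \<in> {1..n}"
  shows "minor (left i) (right j) * witness \<in> J"
proof (cases "i = j")
  case False
  then have "1 * minor (left i) (right j) \<in> J"
    using ij edge_minor_in_J left_right_edge(1) by simp
  then show ?thesis
    by (rule witness_multiple[where r = witness]) (simp_all add: witness_in_carrier)
next
  case True
  obtain k k' :: nat where k: "k \<noteq> i" "{k, k'} = {1, 2}"
  proof (cases "i = 1")
    case True
    then show ?thesis using that[of 2 1] by auto
  next
    case False
    then show ?thesis using that[of 1 2] by auto
  qed
  obtain l l' :: nat where l: "l \<noteq> i" "{l, l'} = {3, 4}"
  proof (cases "i = 3")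
    case True
    then show ?thesis using that[of 4 3] by auto
  next
    case False
    then show ?thesis using that[of 3 4] by auto
  qed
  have kl: "k \<in> {1..n}" "k' \<in> {1..n}" "l \<in> {1..n}" "l' \<in> {1..n}" "k \<noteq> l"
    using k l small_indices by (auto simp: doubleton_eq_iff)
  have "x (left k) * minor (right l) (right i) \<in> J"
    using ij k l kl by (intro two_step_path left_right_edge) auto
  then have "x (left k) * x (right l) * minor (left i) (right i) \<in> J"
    using ij k l kl x_in_carrier right_vertex by (intro extend_path left_right_edge) auto
  then have "minor (left i) (right i) * witness \<in> J"
    by (rule witness_multiple[where r = "x (left k') * x (right l')"])
      (use k l n in \<open>auto simp: witness_def ac_simps doubleton_eq_iff intro!: carrier_mult x_in_carrier\<close>)
  then show ?thesis using True by simp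
qed

lemma minor_times_witness:
  assumes "u \<in> {1..2 * n}" "v \<in> {1..2 * n}"
  shows "minor u v * witness \<in> J"
  using assms(1)
proof (cases rule: crown_vertex_cases)
  case u: (1 i)
  from assms(2) show ?thesis
  proof (cases rule: crown_vertex_cases)
    case (1 j)
    with u show ?thesis
      using minor_left_left[of i j] by (cases "i = j") (auto simp: minor_def ideal_poly_zero[OF J_ideal])
  next
    case (2 j)
    with u show ?thesis using minor_left_right by simp
  qed
next
  case u: (2 i)
  from assms(2) show ?thesis
  proof (cases rule: crown_vertex_cases)
    case (1 j)
    with u have "- (minor (left j) (right i) * witness) \<in> J"
      by (intro ideal_poly_uminus[OF J_ideal] minor_left_right)
    with 1 u show ?thesis by (simp add: minor_swap[of "right i" "left j"])
  next
    case (2 j)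
    with u show ?thesis
      using minor_right_right[of i j] by (cases "i = j") (auto simp: minor_def ideal_poly_zero[OF J_ideal])
  qed
qed

lemma colon_witness: "colon R J witness = {p \<in> carrier R. label_hom whole p = 0}"
proof (rule Set.set_eqI)
  fix g
  have "label_hom whole (x v) \<noteq> 0" for v
  proof -
    have "Poly_Mapping.keys (label_hom whole (x v)) \<noteq> {}"
      by (simp add: var_def label_hom_single survives_def)
    then show ?thesis by auto
  qed
  then have nonzero: "label_hom whole witness \<noteq> 0"
    by (simp add: witness_def label_hom_mult)
  show "g \<in> colon R J witness \<longleftrightarrow> g \<in> {p \<in> carrier R. label_hom whole p = 0}"
  proof
    assume "g \<in> colon R J witness"
    then show "g \<in> {p \<in> carrier R. label_hom whole p = 0}"
      using J_in_kernel[OF compatible_labellings(1), of "g * witness"] nonzero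
      by (simp add: colon_ideal_mem_iff label_hom_mult)
  next
    assume g: "g \<in> {p \<in> carrier R. label_hom whole p = 0}"
    show "g \<in> colon R J witness"
    proof (rule kernel_generated_by_minors[OF colon_ideal[OF J_ideal]])
      fix u v assume "u \<in> fst (crown_graph n)" "v \<in> fst (crown_graph n)"
      then show "minor u v \<in> colon R J witness"
        using minor_times_witness[of u v]
        by (simp add: colon_ideal_mem_iff minor_in_carrier crown_graph_vertices[of n])
    qed (use g in auto)
  qed
qed

lemma v_number_upper_bound: "v_number (xy_vars (crown_graph n)) J \<le> 4"
proof -
  have eq: "witness = Poly_Mapping.single (Poly_Mapping.single (XVar (left 1)) 1 + Poly_Mapping.single (XVar (left 2)) 1 +
      Poly_Mapping.single (XVar (right 3)) 1 + Poly_Mapping.single (XVar (right 4)) 1) 1"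
    by (simp add: witness_def var_def mult_single)
  have hom: "witness \<in> hom_component (xy_vars (crown_graph n)) 4"
    using witness_in_carrier unfolding hom_component_def eq
    by (simp add: monom_degree_plus monom_degree_single)
  have "colon R J witness \<in> Ass R J"
    unfolding Ass_def using witness_in_carrier
    by (intro CollectI conjI bexI[of _ witness]) (simp_all add: colon_witness prime_kernel)
  then have "v_number (xy_vars (crown_graph n)) J \<le> local_v_number (xy_vars (crown_graph n)) J (colon R J witness)"
    unfolding v_number_def by (intro Inf_lower CollectI exI conjI) (rule refl)
  also have "\<dots> \<le> enat 4"
    unfolding local_v_number_def by (intro Inf_lower CollectI exI conjI) (rule refl, rule bexI[OF refl hom])
  finally show ?thesis by (simp add: numeral_eq_enat)
qed

end

theorem theorem5p5:
  fixes n :: nat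
    and G :: "nat graph"
    and J :: "(nat xy_var, 'k::field) mpoly set"
  assumes "n \<ge> 4"
    and "G = crown_graph n"
    and "J = binomial_edge_ideal G"
  shows "3 \<le> v_number (xy_vars G) J \<and> v_number (xy_vars G) J \<le> 4"
proof -
  interpret crown n J
    using assms by (intro crown.intro edge_ideal_crown crown_axioms.intro) auto
  show ?thesis
    using assms(2) v_number_lower_bound v_number_upper_bound by simp
qed

end
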